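(* Every interval translation map $S:\mathbb{T}^1\to\mathbb{T}^1$ of the circle $\mathbb{T}^1=\mathbb{R}/\mathbb{Z}$ admits a non-atomic $S$-invariant Borel probability measure.
   Context: An interval translation map (ITM) of the circle $\mathbb{T}^1=\mathbb{R}/\mathbb{Z}$ is a map $S:\mathbb{T}^1\to\mathbb{T}^1$ for which there are $n\in\mathbb{N}$, points $t_0,t_1,\ldots,t_n=t_0$ of $\mathbb{T}^1$ in cyclic order such that the half-open arcs $[t_j,t_{j+1})$, $j=0,\ldots,n-1$, are disjoint and cover $\mathbb{T}^1$, and real numbers $c_j$ such that $S(t)=t+c_j \bmod 1$ for $t\in[t_j,t_{j+1})$. $S$ is not assumed injective or surjective. A Borel probability measure $\mu$ is $S$-invariant if $\mu(S^{-1}(A))=\mu(A)$ for every measurable set $A$; it is non-atomic if every singleton has measure zero. *)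

theory Defs
  imports "HOL-Probability.Probability"
begin

quotient_type circle = real / "\<lambda>x y :: real. x - y \<in> \<int>"
  morphisms rep_circle proj_circle
proof (rule equivpI)
  show "reflp (\<lambda>x y :: real. x - y \<in> \<int>)"
    by (auto intro: reflpI)
  show "symp (\<lambda>x y :: real. x - y \<in> \<int>)"
    by (metis (mono_tags, lifting) Ints_minus minus_diff_eq sympI)
  show "transp (\<lambda>x y :: real. x - y \<in> \<int>)"
    by (rule transpI) (metis Ints_add diff_add_cancel add_diff_eq)
qed

lemma proj_circle_eq_iff: "proj_circle x = proj_circle y \<longleftrightarrow> x - y \<in> \<int>"
  by (rule circle.abs_eq_iff)

lemma proj_circle_surj: "\<exists>x. proj_circle x = p"
  by (metis Quotient3_abs_rep Quotient3_circle)

text \<open>The quotient topology; \<open>borel :: circle measure\<close> is then the Borel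
  \<open>\<sigma>\<close>-algebra of the circle.\<close>

instantiation circle :: t1_space
begin

definition open_circle :: "circle set \<Rightarrow> bool"
  where "open_circle U \<longleftrightarrow> open (proj_circle -` U)"

instance
proof
  show "open (UNIV :: circle set)"
    by (simp add: open_circle_def)
  show "open (U \<inter> V)" if "open U" "open V" for U V :: "circle set"
    using that by (simp add: open_circle_def open_Int)
  show "open (\<Union>K)" if "\<forall>U\<in>K. open U" for K :: "circle set set"
    using that by (simp add: open_circle_def vimage_Union open_UN)
  show "\<exists>U. open U \<and> p \<in> U \<and> q \<notin> U" if "p \<noteq> q" for p q :: circle
  proof -
    obtain y where y: "proj_circle y = q"
      using proj_circle_surj by blast
    have "proj_circle -` (- {q}) = - ((\<lambda>z. y + z) ` \<int>)"
      unfolding y[symmetric]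
      by (auto simp: proj_circle_eq_iff image_iff) (metis add.commute diff_add_cancel)
    moreover have "closed ((\<lambda>z. y + z) ` (\<int> :: real set))"
      by (rule closed_translation) (rule closed_Ints)
    ultimately have "open (- {q})"
      by (simp add: open_circle_def open_Compl)
    with that show ?thesis
      by blast
  qed
qed

end

text \<open>A cyclically ordered list of points \<open>t\<^sub>0, \<dots>, t\<^sub>n = t\<^sub>0\<close> of the circle is given by
  real lifts \<open>t 0 < \<dots> < t n = t 0 + 1\<close>, running once around the circle.  The arc
  \<open>[t\<^sub>j, t\<^sub>j\<^sub>+\<^sub>1)\<close> is the image of the real interval between consecutive lifts, so for
  \<open>n = 1\<close> the only arc is the whole circle.\<close>

definition cyclic_lift :: "nat \<Rightarrow> (nat \<Rightarrow> real) \<Rightarrow> bool"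
  where "cyclic_lift n t \<longleftrightarrow> (\<forall>j<n. t j < t (Suc j)) \<and> t n = t 0 + 1"

definition arc_circle :: "real \<Rightarrow> real \<Rightarrow> circle set"
  where "arc_circle a b = proj_circle ` {a..<b}"

lemma cyclic_lift_mono:
  assumes "cyclic_lift n t" "i \<le> j" "j \<le> n"
  shows "t i \<le> t j"
  using assms(2,3)
proof (induction j rule: dec_induct)
  case (step k)
  then have "t i \<le> t k" "t k < t (Suc k)"
    using assms(1) by (auto simp: cyclic_lift_def)
  then show ?case
    by simp
qed simp

lemma cyclic_lift_disjoint:
  assumes "cyclic_lift n t"
  shows "disjoint_family_on (\<lambda>j. arc_circle (t j) (t (Suc j))) {..<n}"
proof -
  have *: "arc_circle (t i) (t (Suc i)) \<inter> arc_circle (t j) (t (Suc j)) = {}"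
    if "i < j" "j < n" for i j
  proof (rule ccontr)
    assume "\<not> ?thesis"
    then obtain x y where xy: "x \<in> {t i..<t (Suc i)}" "y \<in> {t j..<t (Suc j)}"
      and "proj_circle y = proj_circle x"
      unfolding arc_circle_def by fastforce
    then obtain k where k: "y - x = of_int k"
      by (auto simp: proj_circle_eq_iff elim: Ints_cases)
    have "t (Suc i) \<le> t j" "t (Suc j) \<le> t n" "t 0 \<le> t i"
      using that by (auto intro!: cyclic_lift_mono[OF assms])
    moreover have "t n = t 0 + 1"
      using assms by (simp add: cyclic_lift_def)
    ultimately have "0 < y - x" "y - x < 1"
      using xy by auto
    then show False
      unfolding k by simp
  qed
  show ?thesis
    unfolding disjoint_family_on_def
    by (metis * Int_commute lessThan_iff linorder_neqE_nat)
qed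

lemma cyclic_lift_cover:
  assumes "cyclic_lift n t"
  shows "(\<Union>j<n. arc_circle (t j) (t (Suc j))) = UNIV"
proof -
  have "\<exists>j<n. p \<in> arc_circle (t j) (t (Suc j))" for p
  proof -
    obtain y where y: "proj_circle y = p"
      using proj_circle_surj by blast
    define x where "x = t 0 + frac (y - t 0)"
    have "x - y = - of_int \<lfloor>y - t 0\<rfloor>"
      by (simp add: x_def frac_def)
    then have px: "proj_circle x = p"
      unfolding y[symmetric] proj_circle_eq_iff by simp
    have x: "t 0 \<le> x" "x < t n"
      using assms frac_lt_1[of "y - t 0"] by (auto simp: x_def cyclic_lift_def)
    define m where "m = (LEAST m. x < t m)"
    have m: "x < t m" "m \<le> n"
      unfolding m_def using x by (auto intro: LeastI Least_le)
    obtain j where j: "m = Suc j"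
      using m x by (cases m) auto
    have "\<not> x < t j"
      using not_less_Least[of j "\<lambda>m. x < t m"] j by (simp add: m_def)
    then show ?thesis
      using m j px by (auto simp: arc_circle_def intro!: exI[of _ j])
  qed
  then show ?thesis
    by blast
qed

definition interval_translation_map :: "(circle \<Rightarrow> circle) \<Rightarrow> bool"
  where "interval_translation_map S \<longleftrightarrow>
    (\<exists>n t c. cyclic_lift n t \<and>
      (\<forall>j<n. \<forall>x\<in>{t j..<t (Suc j)}. S (proj_circle x) = proj_circle (x + c j)))"

definition borel_probability_measure :: "'a::topological_space measure \<Rightarrow> bool"
  where "borel_probability_measure \<mu> \<longleftrightarrow> sets \<mu> = sets borel \<and> prob_space \<mu>"

text \<open>Measurability of \<open>S\<close> is part of invariance: the library assigns measure \<open>0\<close> to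
  non-measurable sets, so the equation alone would be meaningless otherwise.\<close>

definition invariant_measure :: "'a measure \<Rightarrow> ('a \<Rightarrow> 'a) \<Rightarrow> bool"
  where "invariant_measure \<mu> S \<longleftrightarrow> S \<in> measurable \<mu> \<mu> \<and>
    (\<forall>A\<in>sets \<mu>. emeasure \<mu> (S -` A \<inter> space \<mu>) = emeasure \<mu> A)"

definition non_atomic :: "'a measure \<Rightarrow> bool"
  where "non_atomic \<mu> \<longleftrightarrow> (\<forall>x\<in>space \<mu>. emeasure \<mu> {x} = 0)"

end

theory Submission
  imports Defs "HOL-Real_Asymp.Real_Asymp"
begin

text \<open>
  Lift \<open>S\<close> to \<open>f x = x + d x\<close> on the line, where \<open>d\<close> is 1-periodic and locally constant on
  each side of every point; the same then holds for the displacement of each iterate of \<open>f\<close>.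

  If \<open>S\<^sup>p\<close> fixes a point, it fixes an arc to the right of this point, and the average of the
  Lebesgue measures on the first \<open>p\<close> images of a short arc is invariant.

  Suppose now that there is no periodic point, and let \<open>M\<close> be a weak limit of empirical measures
  along an orbit.  On a short one-sided neighbourhood of any point the iterates \<open>S, \<dots>, S\<^sup>N\<close>
  are non-trivial rotations, so an orbit visits this neighbourhood with frequency at most about
  \<open>1 / N\<close>.  Hence \<open>M\<close> has no atoms, the countably many discontinuities of \<open>S\<close> do
  not matter in the limit, and \<open>M\<close> is invariant.
\<close>

section \<open>Counting, null sets, tightness and integer translations\<close>

lemma card_spaced_le:
  fixes V :: "nat set"
  assumes "V \<subseteq> {..<n}" and "N > 0"
    and spaced: "\<And>k l. k \<in> V \<Longrightarrow> l \<in> V \<Longrightarrow> k < l \<Longrightarrow> k + N \<le> l"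
  shows "card V \<le> n div N + 1"
proof -
  \<comment> \<open>Elements at distance at least \<open>N\<close> lie in different blocks of length
    \<open>N\<close>, so counting blocks bounds \<open>card V\<close>.\<close>
  have "inj_on (\<lambda>k. k div N) V"
  proof (rule linorder_inj_onI)
    fix k l assume "k < l" "k \<in> V" "l \<in> V"
    then have "(k + N) div N \<le> l div N"
      using spaced by (intro div_le_mono) auto
    then show "k div N \<noteq> l div N"
      using \<open>N > 0\<close> by simp
  qed auto
  moreover have "(\<lambda>k. k div N) ` V \<subseteq> {..n div N}"
    using assms(1) by (auto intro!: div_le_mono dest: subsetD)
  ultimately have "card V \<le> card {..n div N}"
    by (metis card_image card_mono finite_atMost)
  then show ?thesis
    by simp
qed

lemma emeasure_countable_eq_0:
  assumes "countable C" "\<And>x. {x} \<in> sets M" "\<And>x. emeasure M {x} = 0"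
  shows "emeasure M C = 0"
proof -
  have "(\<Union>x\<in>C. {x}) \<in> null_sets M"
    using assms by (intro null_sets_UN') (auto simp: null_sets_def)
  then show ?thesis
    by (simp add: null_sets_def)
qed

text \<open>A common bounded support makes the sequence tight, so Prokhorov's theorem applies. The
  interval is half-open because tightness is phrased with such intervals; it contains all of
  \<open>[0, 1)\<close>.\<close>

lemma exists_weak_limit_in_unit_interval:
  assumes dist: "\<And>n. real_distribution (\<mu> n)"
    and supp: "\<And>n. measure (\<mu> n) {-1<..1} = 1"
  obtains r M where "strict_mono (r :: nat \<Rightarrow> nat)" "real_distribution M" "weak_conv_m (\<mu> \<circ> r) M"
proof -
  have "tight \<mu>"
    unfolding tight_def
  proof (intro conjI allI impI)
    fix \<epsilon> :: real assume "\<epsilon> > 0"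
    then have "(-1 :: real) < 1 \<and> (\<forall>n. 1 - \<epsilon> < measure (\<mu> n) {-1<..1})"
      by (simp add: supp)
    then show "\<exists>a b. a < b \<and> (\<forall>n. 1 - \<epsilon> < measure (\<mu> n) {a<..b})"
      by blast
  qed (rule dist)
  from tight_imp_convergent_subsubsequence[OF this strict_mono_id] that show thesis
    by auto
qed

text \<open>The integers are closed, so \<open>c\<close> has a positive distance \<epsilon> to them,
  and \<open>z + c - w\<close> lies within \<epsilon> of \<open>c\<close>.\<close>

lemma translation_no_return:
  fixes c :: real
  assumes "c \<notin> \<int>"
  shows "\<exists>\<epsilon>>0. \<forall>z w. \<bar>z - w\<bar> < \<epsilon> \<longrightarrow> z + c - w \<notin> \<int>"
proof -
  have "open (- \<int> :: real set)"
    by (simp add: open_Compl closed_Ints)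
  then obtain \<epsilon> where \<epsilon>: "\<epsilon> > 0" "ball c \<epsilon> \<subseteq> - \<int>"
    using assms openE by blast
  have "z + c - w \<in> ball c \<epsilon>" if "\<bar>z - w\<bar> < \<epsilon>" for z w
    using that by (simp add: dist_real_def)
  with \<epsilon> show ?thesis
    by blast
qed

lemma frac_diff_Ints: "x - frac x \<in> \<int>" "frac x - x \<in> \<int>" for x :: real
  by (simp_all add: frac_def)

lemma borel_measurable_frac [measurable]: "frac \<in> borel_measurable (borel :: real measure)"
  unfolding frac_def by measurable

subsection \<open>Return times of piecewise translations\<close>

text \<open>\<open>d\<close> is the displacement of a lift. Constancy on the right includes
  \<open>y\<close> itself, since arcs are closed on the left; the constant on the left may differ
  from \<open>d y\<close>. Countability makes exceptional sets null for measures without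
  atoms.\<close>

locale piecewise_translation =
  fixes d :: "real \<Rightarrow> real"
  assumes periodic: "x - y \<in> \<int> \<Longrightarrow> d x = d y"
    and right_const: "\<exists>\<delta>>0. \<forall>z\<in>{y..<y+\<delta>}. d z = d y"
    and left_const: "\<exists>\<delta>>0. \<exists>c. \<forall>z\<in>{y-\<delta><..<y}. d z = c"
    and countable_range: "countable (range d)"
    and countable_discont: "countable {x. \<not> isCont d x}"
begin

definition f :: "real \<Rightarrow> real"
  where "f x = x + d x"

lemma f_diff_Ints: "x - y \<in> \<int> \<Longrightarrow> f x - f y \<in> \<int>"
  using periodic[of x y] by (simp add: f_def)

lemma funpow_f_diff_Ints: "x - y \<in> \<int> \<Longrightarrow> (f ^^ k) x - (f ^^ k) y \<in> \<int>"
  by (induction k) (auto intro: f_diff_Ints)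

lemma isCont_f: "isCont d x \<Longrightarrow> isCont f x"
  unfolding f_def by (intro continuous_intros)

lemma f_measurable [measurable]: "f \<in> borel_measurable borel"
proof (rule borel_measurable_continuous_countable_exceptions[OF countable_discont])
  show "continuous_on (- {x. \<not> isCont d x}) f"
    by (auto intro!: continuous_at_imp_continuous_on isCont_f)
qed

text \<open>Translations preserve orientation: a short right neighbourhood of \<open>y\<close> is
  carried to a right neighbourhood of \<open>(f ^^ k) y\<close>, where \<open>d\<close> is again
  constant.\<close>

lemma funpow_f_right:
  "\<exists>\<delta>>0. \<forall>z\<in>{y..<y+\<delta>}. (f ^^ k) z = z + ((f ^^ k) y - y)"
proof (induction k)
  case 0
  show ?case
    by (rule exI[of _ 1]) simp
next
  case (Suc k)
  then obtain \<delta>1 where 1: "\<delta>1 > 0" "\<And>z. z \<in> {y..<y+\<delta>1} \<Longrightarrow> (f ^^ k) z = z + ((f ^^ k) y - y)"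
    by blast
  obtain \<delta>2 where 2: "\<delta>2 > 0" "\<And>z. z \<in> {(f ^^ k) y..<(f ^^ k) y+\<delta>2} \<Longrightarrow> d z = d ((f ^^ k) y)"
    using right_const by blast
  have "(f ^^ Suc k) z = z + ((f ^^ Suc k) y - y)" if "z \<in> {y..<y + min \<delta>1 \<delta>2}" for z
    using that 1(2)[of z] 2(2)[of "(f ^^ k) z"] by (auto simp: f_def)
  moreover have "min \<delta>1 \<delta>2 > 0"
    using 1(1) 2(1) by simp
  ultimately show ?case
    by blast
qed

text \<open>The induction follows the left limit \<open>y + c1\<close> of the iterate instead of its
  value at \<open>y\<close>, because \<open>d\<close> may jump there.\<close>

lemma funpow_f_left:
  "\<exists>\<delta>>0. \<exists>c. \<forall>z\<in>{y-\<delta><..<y}. (f ^^ k) z = z + c"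
proof (induction k)
  case 0
  show ?case
    by (intro exI[of _ 1] conjI exI[of _ 0]) simp_all
next
  case (Suc k)
  then obtain \<delta>1 c1 where 1: "\<delta>1 > 0" "\<And>z. z \<in> {y-\<delta>1<..<y} \<Longrightarrow> (f ^^ k) z = z + c1"
    by blast
  obtain \<delta>2 c2 where 2: "\<delta>2 > 0" "\<And>z. z \<in> {y+c1-\<delta>2<..<y+c1} \<Longrightarrow> d z = c2"
    using left_const[of "y + c1"] by blast
  have "(f ^^ Suc k) z = z + (c1 + c2)" if "z \<in> {y - min \<delta>1 \<delta>2<..<y}" for z
    using that 1(2)[of z] 2(2)[of "(f ^^ k) z"] by (auto simp: f_def)
  moreover have "min \<delta>1 \<delta>2 > 0"
    using 1(1) 2(1) by simp
  ultimately show ?case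
    by blast
qed

definition no_return :: "nat \<Rightarrow> real set \<Rightarrow> bool"
  where "no_return k I \<longleftrightarrow> (\<forall>z\<in>I. \<forall>w\<in>I. (f ^^ k) z - w \<notin> \<int>)"

lemma no_return_mono: "no_return k J \<Longrightarrow> I \<subseteq> J \<Longrightarrow> no_return k I"
  unfolding no_return_def by blast

text \<open>Aperiodicity makes \<open>c\<close> a non-integer, so short pieces of \<open>I\<close>
  are moved off themselves. The bound \<epsilon> is uniform in \<open>a\<close> because the left end
  of a left neighbourhood moves with its length.\<close>

lemma no_return_translation:
  assumes aper: "\<And>x. (f ^^ k) x - x \<notin> \<int>"
    and "z0 \<in> I" and trans: "\<And>z. z \<in> I \<Longrightarrow> (f ^^ k) z = z + c"
  shows "\<exists>\<epsilon>>0. \<forall>a. no_return k (I \<inter> {a..<a+\<epsilon>})"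
proof -
  have "c \<notin> \<int>"
    using aper[of z0] trans[OF \<open>z0 \<in> I\<close>] by simp
  then obtain \<epsilon> where \<epsilon>: "\<epsilon> > 0" "\<And>z w. \<bar>z - w\<bar> < \<epsilon> \<Longrightarrow> z + c - w \<notin> \<int>"
    using translation_no_return by metis
  have "(f ^^ k) z - w \<notin> \<int>" if "z \<in> I \<inter> {a..<a+\<epsilon>}" "w \<in> I \<inter> {a..<a+\<epsilon>}" for a z w
  proof -
    have "\<bar>z - w\<bar> < \<epsilon>"
      using that by (simp add: abs_less_iff)
    then show ?thesis
      using \<epsilon>(2) trans[of z] that by simp
  qed
  with \<epsilon>(1) show ?thesis
    unfolding no_return_def by blast
qed

lemma eventually_no_return_right:
  assumes aper: "\<And>x. (f ^^ k) x - x \<notin> \<int>"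
  shows "\<forall>\<^sub>F \<delta> in at_right 0. no_return k {y..<y+\<delta>}"
proof -
  obtain \<delta>1 where 1: "\<delta>1 > 0" "\<And>z. z \<in> {y..<y+\<delta>1} \<Longrightarrow> (f ^^ k) z = z + ((f ^^ k) y - y)"
    using funpow_f_right by blast
  have mem: "y \<in> {y..<y+\<delta>1}"
    using 1(1) by simp
  obtain \<epsilon> where \<epsilon>: "\<epsilon> > 0" "\<forall>a. no_return k ({y..<y+\<delta>1} \<inter> {a..<a+\<epsilon>})"
    using no_return_translation[OF aper mem 1(2)] by blast
  have "no_return k {y..<y+\<delta>}" if "\<delta> < min \<delta>1 \<epsilon>" for \<delta>
  proof -
    have "{y..<y+\<delta>} \<subseteq> {y..<y+\<delta>1} \<inter> {y..<y+\<epsilon>}"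
      using that by auto
    then show ?thesis
      using \<epsilon>(2) no_return_mono by blast
  qed
  moreover have "min \<delta>1 \<epsilon> > 0"
    using 1(1) \<epsilon>(1) by simp
  ultimately show ?thesis
    unfolding eventually_at_right_field by blast
qed

lemma eventually_no_return_left:
  assumes aper: "\<And>x. (f ^^ k) x - x \<notin> \<int>"
  shows "\<forall>\<^sub>F \<delta> in at_right 0. no_return k {y-\<delta><..<y}"
proof -
  obtain \<delta>1 c where 1: "\<delta>1 > 0" "\<And>z. z \<in> {y-\<delta>1<..<y} \<Longrightarrow> (f ^^ k) z = z + c"
    using funpow_f_left by blast
  have mem: "y - \<delta>1 / 2 \<in> {y-\<delta>1<..<y}"
    using 1(1) by simp
  obtain \<epsilon> where \<epsilon>: "\<epsilon> > 0" "\<forall>a. no_return k ({y-\<delta>1<..<y} \<inter> {a..<a+\<epsilon>})"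
    using no_return_translation[OF aper mem 1(2)] by blast
  have "no_return k {y-\<delta><..<y}" if "\<delta> < min \<delta>1 \<epsilon>" for \<delta>
  proof -
    have "{y-\<delta><..<y} \<subseteq> {y-\<delta>1<..<y} \<inter> {y - \<delta>..<y - \<delta>+\<epsilon>}"
      using that by auto
    then show ?thesis
      using \<epsilon>(2) no_return_mono by blast
  qed
  moreover have "min \<delta>1 \<epsilon> > 0"
    using 1(1) \<epsilon>(1) by simp
  ultimately show ?thesis
    unfolding eventually_at_right_field by blast
qed

subsection \<open>Weak limits of empirical measures\<close>

text \<open>Representatives in \<open>[0, 1)\<close> keep the orbit bounded, as tightness requires;
  the starting point 0 is arbitrary.\<close>

definition orbit :: "nat \<Rightarrow> real"
  where "orbit k = frac ((f ^^ k) 0)"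

lemma orbit_bounds: "0 \<le> orbit k" "orbit k < 1"
  by (auto simp: orbit_def frac_lt_1)

lemma orbit_add: "(f ^^ j) (orbit k) - orbit (j + k) \<in> \<int>"
proof -
  have "(f ^^ j) (orbit k) - (f ^^ j) ((f ^^ k) 0) \<in> \<int>"
    unfolding orbit_def by (intro funpow_f_diff_Ints frac_diff_Ints)
  moreover have "(f ^^ (j + k)) 0 - orbit (j + k) \<in> \<int>"
    unfolding orbit_def by (rule frac_diff_Ints)
  ultimately have "((f ^^ j) (orbit k) - (f ^^ j) ((f ^^ k) 0)) + ((f ^^ (j + k)) 0 - orbit (j + k)) \<in> \<int>"
    by (rule Ints_add)
  then show ?thesis
    by (simp add: funpow_add)
qed

lemma orbit_Suc: "orbit (Suc k) = frac (f (orbit k))"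
proof -
  have "f (orbit k) - f ((f ^^ k) 0) \<in> \<int>"
    unfolding orbit_def by (intro f_diff_Ints frac_diff_Ints)
  then obtain m :: int where "f (orbit k) = f ((f ^^ k) 0) + of_int m"
    by (metis Ints_cases add.commute diff_add_cancel)
  then show ?thesis
    by (simp add: orbit_def frac_def)
qed

text \<open>Two visits to \<open>I\<close> at times differing by some \<open>j\<close> in
  \<open>{1..N}\<close> would contradict \<open>no_return j I\<close>, so the visiting times are
  spaced.\<close>

lemma card_visits_le:
  assumes "N > 0" and nr: "\<And>k. k \<in> {1..N} \<Longrightarrow> no_return k I"
  shows "card {k\<in>{..<n}. orbit k \<in> I} \<le> n div N + 1"
proof (rule card_spaced_le)
  fix k l assume "k \<in> {k\<in>{..<n}. orbit k \<in> I}" "l \<in> {k\<in>{..<n}. orbit k \<in> I}" "k < l"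
  then show "k + N \<le> l"
    using orbit_add[of "l - k" k] nr[of "l - k"]
    by (force simp: no_return_def not_le)
qed (use assms in auto)

text \<open>The average runs over the \<open>n + 1\<close> times \<open>0, ..., n\<close>, so it is
  defined for every \<open>n\<close>; this is the source of the denominators
  \<open>Suc n\<close>.\<close>

definition empirical :: "nat \<Rightarrow> real measure"
  where "empirical n = distr (measure_pmf (pmf_of_set {..n})) borel orbit"

lemma real_distribution_empirical: "real_distribution (empirical n)"
  unfolding empirical_def by (intro real_distribution.intro real_distribution_axioms.intro
    prob_space.prob_space_distr prob_space_measure_pmf) auto

lemma integral_empirical:
  fixes h :: "real \<Rightarrow> real"
  assumes "h \<in> borel_measurable borel"
  shows "(\<integral>x. h x \<partial>empirical n) = (\<Sum>k\<le>n. h (orbit k)) / Suc n"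
  unfolding empirical_def using assms by (subst integral_distr) (auto simp: integral_pmf_of_set)

lemma measure_empirical:
  assumes [measurable]: "A \<in> sets borel"
  shows "measure (empirical n) A = card {k\<in>{..<Suc n}. orbit k \<in> A} / Suc n"
proof -
  interpret real_distribution "empirical n" by (rule real_distribution_empirical)
  have "measure (empirical n) A = (\<integral>x. indicator A x \<partial>empirical n)"
    by simp
  also have "\<dots> = (\<Sum>k\<in>{..<Suc n}. indicator A (orbit k)) / Suc n"
    by (subst integral_empirical) (auto simp: lessThan_Suc_atMost)
  also have "(\<Sum>k\<in>{..<Suc n}. indicator A (orbit k)) = (\<Sum>k\<in>{..<Suc n}. if orbit k \<in> A then 1 else 0 :: real)"
    by (intro sum.cong) (auto simp: indicator_def)
  also have "\<dots> = card {k\<in>{..<Suc n}. orbit k \<in> A}"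
    by (simp add: sum.If_cases Int_def del: sum.lessThan_Suc)
  finally show ?thesis .
qed

text \<open>The iterates may be different translations on the two sides of \<open>y\<close>, so the
  two halves are counted separately. Each contributes at most
  \<open>1 / N + 1 / Suc n\<close>.\<close>

lemma measure_empirical_nhds_le:
  fixes N :: nat
  assumes aper: "\<And>k x. k > 0 \<Longrightarrow> (f ^^ k) x - x \<notin> \<int>" and "N > 0"
  shows "\<exists>\<delta>>0. \<forall>n. measure (empirical n) {y-\<delta><..<y+\<delta>} \<le> 2 / N + 2 / Suc n"
proof -
  \<comment> \<open>Only finitely many \<open>k\<close> occur, so a single \<delta> serves all of
    them and both sides.\<close>
  have "\<forall>\<^sub>F \<delta> in at_right 0. \<forall>k\<in>{1..N}. no_return k {y..<y+\<delta>} \<and> no_return k {y-\<delta><..<y}"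
    using aper by (intro eventually_ball_finite ballI eventually_conj
        eventually_no_return_left eventually_no_return_right) auto
  then obtain b where b: "b > 0"
    "\<And>\<delta>. 0 < \<delta> \<Longrightarrow> \<delta> < b \<Longrightarrow> \<forall>k\<in>{1..N}. no_return k {y..<y+\<delta>} \<and> no_return k {y-\<delta><..<y}"
    unfolding eventually_at_right_field by blast
  define \<delta> where "\<delta> = b / 2"
  have nr: "no_return k {y..<y+\<delta>}" "no_return k {y-\<delta><..<y}" if "k \<in> {1..N}" for k
    using b(1) b(2)[of \<delta>] that by (auto simp: \<delta>_def)
  have "\<delta> > 0" using b(1) by (simp add: \<delta>_def)
  moreover have "measure (empirical n) {y-\<delta><..<y+\<delta>} \<le> 2 / N + 2 / Suc n" for n
  proof -
    have "{k\<in>{..<Suc n}. orbit k \<in> {y-\<delta><..<y+\<delta>}} \<subseteq>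
        {k\<in>{..<Suc n}. orbit k \<in> {y-\<delta><..<y}} \<union> {k\<in>{..<Suc n}. orbit k \<in> {y..<y+\<delta>}}"
      by auto
    then have "card {k\<in>{..<Suc n}. orbit k \<in> {y-\<delta><..<y+\<delta>}} \<le>
        card ({k\<in>{..<Suc n}. orbit k \<in> {y-\<delta><..<y}} \<union> {k\<in>{..<Suc n}. orbit k \<in> {y..<y+\<delta>}})"
      by (intro card_mono) auto
    also have "\<dots> \<le> card {k\<in>{..<Suc n}. orbit k \<in> {y-\<delta><..<y}} + card {k\<in>{..<Suc n}. orbit k \<in> {y..<y+\<delta>}}"
      by (rule card_Un_le)
    also have "\<dots> \<le> (Suc n div N + 1) + (Suc n div N + 1)"
      using \<open>N > 0\<close> nr by (intro add_mono card_visits_le) auto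
    finally have "real (card {k\<in>{..<Suc n}. orbit k \<in> {y-\<delta><..<y+\<delta>}}) \<le> 2 * real (Suc n div N) + 2"
      by linarith
    also have "\<dots> \<le> 2 * (Suc n / N) + 2"
      by (intro add_right_mono mult_left_mono of_nat_div_le_of_nat) simp
    finally have "real (card {k\<in>{..<Suc n}. orbit k \<in> {y-\<delta><..<y+\<delta>}}) / Suc n \<le> (2 * (Suc n / N) + 2) / Suc n"
      by (intro divide_right_mono) auto
    also have "\<dots> = 2 / N + 2 / Suc n"
      using \<open>N > 0\<close> by (simp add: field_simps del: of_nat_Suc)
    finally show ?thesis
      by (subst measure_empirical) auto
  qed
  ultimately show ?thesis
    by blast
qed

text \<open>Applying \<open>f\<close> shifts the orbit by one step, so the difference telescopes to
  two boundary terms divided by \<open>n + 1\<close>.\<close>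

lemma integral_empirical_shift:
  fixes h :: "real \<Rightarrow> real"
  assumes [measurable]: "h \<in> borel_measurable borel" and bdd: "\<And>x. norm (h x) \<le> B"
  shows "(\<lambda>n. (\<integral>x. h (frac (f x)) \<partial>empirical n) - (\<integral>x. h x \<partial>empirical n)) \<longlonglongrightarrow> 0"
proof (rule Lim_null_comparison)
  show "\<forall>\<^sub>F n in sequentially. norm ((\<integral>x. h (frac (f x)) \<partial>empirical n) - (\<integral>x. h x \<partial>empirical n)) \<le> 2 * B / Suc n"
  proof (intro always_eventually allI)
    fix n
    have "(\<integral>x. h (frac (f x)) \<partial>empirical n) - (\<integral>x. h x \<partial>empirical n) =
        ((\<Sum>k\<le>n. h (orbit (Suc k))) - (\<Sum>k\<le>n. h (orbit k))) / Suc n"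
      by (simp add: integral_empirical orbit_Suc diff_divide_distrib)
    also have "(\<Sum>k\<le>n. h (orbit (Suc k))) - (\<Sum>k\<le>n. h (orbit k)) = h (orbit (Suc n)) - h (orbit 0)"
      by (induction n) auto
    finally have "norm ((\<integral>x. h (frac (f x)) \<partial>empirical n) - (\<integral>x. h x \<partial>empirical n)) =
        norm (h (orbit (Suc n)) - h (orbit 0)) / Suc n"
      by simp
    also have "\<dots> \<le> 2 * B / Suc n"
      using bdd[of "orbit (Suc n)"] bdd[of "orbit 0"] by (intro divide_right_mono) auto
    finally show "norm ((\<integral>x. h (frac (f x)) \<partial>empirical n) - (\<integral>x. h x \<partial>empirical n)) \<le> 2 * B / Suc n" .
  qed
  show "(\<lambda>n. 2 * B / Suc n) \<longlonglongrightarrow> 0"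
    by real_asymp
qed

lemma weak_limit_atomless:
  assumes aper: "\<And>k x. k > 0 \<Longrightarrow> (f ^^ k) x - x \<notin> \<int>"
    and r: "strict_mono r" and M: "real_distribution M" and lim: "weak_conv_m (empirical \<circ> r) M"
  shows "measure M {y} = 0"
proof -
  interpret M: real_distribution M by fact
  have le: "measure M {y} \<le> 2 / N" if N: "N > 0" for N :: nat
  proof -
    obtain \<delta> where \<delta>: "\<delta> > 0" "\<And>n. measure (empirical n) {y-\<delta><..<y+\<delta>} \<le> 2 / N + 2 / Suc n"
      using measure_empirical_nhds_le[OF aper N] by blast
    \<comment> \<open>A continuous tent between the indicators of \<open>{y}\<close> and of the
      \<delta>-neighbourhood: weak convergence applies to it but not to the indicators.\<close>
    define h where "h z = max 0 (1 - \<bar>z - y\<bar> / \<delta>)" for z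
    have cont: "isCont h z" for z
      unfolding h_def using \<delta>(1) by (intro continuous_intros) auto
    have [measurable]: "h \<in> borel_measurable borel"
      by (intro borel_measurable_continuous_onI continuous_at_imp_continuous_on ballI cont)
    have h: "0 \<le> h z" "h z \<le> 1" "indicator {y} z \<le> h z" "h z \<le> indicator {y-\<delta><..<y+\<delta>} z" for z
      using \<delta>(1) by (auto simp: h_def indicator_def field_simps abs_if split: if_splits)
    have "(\<lambda>n. \<integral>x. h x \<partial>(empirical \<circ> r) n) \<longlonglongrightarrow> (\<integral>x. h x \<partial>M)"
      using h cont by (intro weak_conv_imp_integral_bdd_continuous_conv[where B = 1] lim M)
        (auto simp: real_distribution_empirical)
    moreover have "(\<integral>x. h x \<partial>(empirical \<circ> r) n) \<le> 2 / N + 2 / Suc n" for n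
    proof -
      interpret E: real_distribution "empirical (r n)" by (rule real_distribution_empirical)
      have "(\<integral>x. h x \<partial>empirical (r n)) \<le> (\<integral>x. indicator {y-\<delta><..<y+\<delta>} x \<partial>empirical (r n))"
        using h by (intro integral_mono E.integrable_const_bound[where B = 1]) auto
      also have "\<dots> \<le> 2 / N + 2 / Suc (r n)"
        using \<delta>(2)[of "r n"] by simp
      also have "\<dots> \<le> 2 / N + 2 / Suc n"
        using seq_suble[OF r, of n] by (intro add_left_mono divide_left_mono) auto
      finally show ?thesis by simp
    qed
    moreover have "(\<lambda>n. 2 / N + 2 / Suc n) \<longlonglongrightarrow> 2 / N"
      by real_asymp
    ultimately have "(\<integral>x. h x \<partial>M) \<le> 2 / N"
      by (intro LIMSEQ_le) auto
    moreover have "(\<integral>x. indicator {y} x \<partial>M) \<le> (\<integral>x. h x \<partial>M)"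
      using h by (intro integral_mono M.integrable_const_bound[where B = 1]) auto
    ultimately show ?thesis
      by simp
  qed
  have "(\<lambda>n. 2 / Suc n) \<longlonglongrightarrow> 0"
    by real_asymp
  then have "measure M {y} \<le> 0"
    using le[of "Suc _"] by (intro LIMSEQ_le_const) auto
  then show ?thesis
    using measure_nonneg[of M "{y}"] by linarith
qed

text \<open>Distribution functions are compared. The indicator of \<open>{..a}\<close> and its
  composition with the map are discontinuous only on countable sets, which are null, so both
  integrals pass to the limit, where their difference vanishes.\<close>

lemma weak_limit_invariant:
  assumes r: "strict_mono r" and M: "real_distribution M" and lim: "weak_conv_m (empirical \<circ> r) M"
    and atomless: "\<And>y. measure M {y} = 0"
  shows "distr M borel (\<lambda>x. frac (f x)) = M"
proof (rule cdf_unique)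
  interpret M: real_distribution M by fact
  show "real_distribution (distr M borel (\<lambda>x. frac (f x)))"
    by (intro M.real_distribution_distr) measurable
  show "real_distribution M" by fact
  have countable_null: "emeasure M C = 0" if "countable C" for C
    using that by (rule emeasure_countable_eq_0) (auto simp: M.emeasure_eq_measure atomless)
  show "cdf (distr M borel (\<lambda>x. frac (f x))) = cdf M"
  proof
    fix a :: real
    define h :: "real \<Rightarrow> real" where "h = indicator {..a}"
    have [measurable]: "h \<in> borel_measurable borel"
      by (simp add: h_def)
    have bdd: "norm (h x) \<le> 1" for x
      by (simp add: h_def indicator_def)
    have cont_h: "isCont h x" if "x \<noteq> a" for x
      using that by (simp add: h_def isCont_indicator frontier_def)
    \<comment> \<open>\<open>C\<close> contains every \<open>x\<close> for which \<open>f x\<close>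
      is an integer, where \<open>frac\<close> jumps, or \<open>frac (f x) = a\<close>, where
      \<open>h\<close> jumps.\<close>
    define C where "C = (\<Union>m\<in>\<int>. \<Union>c\<in>range d. {m - c, m + a - c})"
    have "countable C"
      unfolding C_def by (intro countable_UN countable_range countable_int) auto
    have cont_hf: "isCont (\<lambda>x. h (frac (f x))) x" if "isCont d x" "x \<notin> C" for x
    proof -
      have "f x \<notin> \<int>"
      proof
        assume "f x \<in> \<int>"
        then have "x \<in> C"
          unfolding C_def by (intro UN_I[of "f x"] UN_I[of "d x"]) (auto simp: f_def)
        with that show False by simp
      qed
      moreover have "frac (f x) \<noteq> a"
      proof
        assume "frac (f x) = a"
        then have "x \<in> C"
          unfolding C_def
          by (intro UN_I[of "of_int \<lfloor>f x\<rfloor>"] UN_I[of "d x"]) (auto simp: f_def frac_def)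
        with that show False by simp
      qed
      ultimately have "isCont (\<lambda>x. frac (f x)) x" "isCont h (frac (f x))"
        using that by (auto intro!: isCont_o2[OF isCont_f continuous_frac] cont_h)
      then show ?thesis
        by (rule isCont_o2)
    qed
    have "countable {x. \<not> isCont (\<lambda>x. h (frac (f x))) x}"
      by (rule countable_subset[OF _ countable_Un[OF countable_discont \<open>countable C\<close>]]) (use cont_hf in auto)
    then have 1: "(\<lambda>n. \<integral>x. h (frac (f x)) \<partial>(empirical \<circ> r) n) \<longlonglongrightarrow> (\<integral>x. h (frac (f x)) \<partial>M)"
      using bdd countable_null
      by (intro weak_conv_imp_bdd_ae_continuous_conv[where B = 1] lim M)
        (auto simp: real_distribution_empirical)
    have "countable {x. \<not> isCont h x}"
      by (rule countable_subset[of _ "{a}"]) (use cont_h in auto)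
    then have 2: "(\<lambda>n. \<integral>x. h x \<partial>(empirical \<circ> r) n) \<longlonglongrightarrow> (\<integral>x. h x \<partial>M)"
      using bdd countable_null
      by (intro weak_conv_imp_bdd_ae_continuous_conv[where B = 1] lim M)
        (auto simp: real_distribution_empirical)
    have "(\<integral>x. h (frac (f x)) \<partial>M) - (\<integral>x. h x \<partial>M) = 0"
      using LIMSEQ_subseq_LIMSEQ[OF integral_empirical_shift[of h 1] r] bdd
      by (intro LIMSEQ_unique[OF tendsto_diff[OF 1 2]]) (simp_all add: comp_def)
    moreover have "(\<integral>x. h x \<partial>distr M borel (\<lambda>x. frac (f x))) = (\<integral>x. h (frac (f x)) \<partial>M)"
      by (intro integral_distr) auto
    ultimately show "cdf (distr M borel (\<lambda>x. frac (f x))) a = cdf M a"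
      by (simp add: cdf_def h_def)
  qed
qed

text \<open>Only \<open>f\<close> modulo 1 is relevant, hence invariance is restricted to 1-periodic sets.\<close>

definition atomless_invariant :: "real measure \<Rightarrow> bool"
  where "atomless_invariant M \<longleftrightarrow> real_distribution M \<and> (\<forall>C. countable C \<longrightarrow> emeasure M C = 0) \<and>
    (\<forall>A\<in>sets borel. (\<forall>x y. x - y \<in> \<int> \<longrightarrow> x \<in> A \<longrightarrow> y \<in> A) \<longrightarrow> emeasure M (f -` A) = emeasure M A)"

lemma exists_atomless_invariant_aperiodic:
  assumes aper: "\<And>k x. k > 0 \<Longrightarrow> (f ^^ k) x - x \<notin> \<int>"
  shows "\<exists>M. atomless_invariant M"
proof -
  have "measure (empirical n) {-1<..1} = 1" for n
    using orbit_bounds by (subst measure_empirical) (auto simp: less_imp_le less_le_trans[of "-1" 0])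
  then obtain r M where r: "strict_mono r" and M: "real_distribution M" and lim: "weak_conv_m (empirical \<circ> r) M"
    using exists_weak_limit_in_unit_interval[of empirical] real_distribution_empirical by blast
  interpret M: real_distribution M by fact
  have atomless: "measure M {y} = 0" for y
    by (rule weak_limit_atomless[OF aper r M lim])
  have "emeasure M C = 0" if "countable C" for C
    using that by (rule emeasure_countable_eq_0) (auto simp: M.emeasure_eq_measure atomless)
  moreover have "emeasure M (f -` A) = emeasure M A"
    if A: "A \<in> sets borel" "\<forall>x y. x - y \<in> \<int> \<longrightarrow> x \<in> A \<longrightarrow> y \<in> A" for A
  proof -
    have "emeasure M A = emeasure (distr M borel (\<lambda>x. frac (f x))) A"
      using weak_limit_invariant[OF r M lim atomless] by simp
    also have "\<dots> = emeasure M ((\<lambda>x. frac (f x)) -` A)"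
      using A(1) by (subst emeasure_distr) auto
    \<comment> \<open>Periodicity of \<open>A\<close> makes the reduction by \<open>frac\<close>
      invisible.\<close>
    also have "(\<lambda>x. frac (f x)) -` A = f -` A"
      using A(2) frac_diff_Ints by blast
    finally show ?thesis by simp
  qed
  ultimately show ?thesis
    unfolding atomless_invariant_def using M by blast
qed

subsection \<open>Periodic orbits\<close>

text \<open>\<open>f\<close> translates each short interval \<open>I k\<close> onto
  \<open>I (Suc k)\<close>, and \<open>I p\<close> is an integer translate of \<open>I 0\<close>;
  hence normalised Lebesgue measure on this cycle of intervals is invariant for periodic
  sets.\<close>

lemma exists_atomless_invariant_periodic:
  assumes "p > 0" and per: "(f ^^ p) x - x \<in> \<int>"
  shows "\<exists>M. atomless_invariant M"
proof -
  have "\<forall>\<^sub>F \<delta> in at_right 0. \<forall>k\<in>{..<p}. \<forall>z\<in>{(f ^^ k) x..<(f ^^ k) x + \<delta>}. d z = d ((f ^^ k) x)"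
  proof (intro eventually_ball_finite ballI)
    fix k
    obtain \<delta> where "\<delta> > 0" "\<forall>z\<in>{(f ^^ k) x..<(f ^^ k) x + \<delta>}. d z = d ((f ^^ k) x)"
      using right_const by blast
    moreover have "{(f ^^ k) x..<(f ^^ k) x + \<epsilon>} \<subseteq> {(f ^^ k) x..<(f ^^ k) x + \<delta>}" if "\<epsilon> < \<delta>" for \<epsilon>
      using that by auto
    ultimately show "\<forall>\<^sub>F \<delta> in at_right 0. \<forall>z\<in>{(f ^^ k) x..<(f ^^ k) x + \<delta>}. d z = d ((f ^^ k) x)"
      unfolding eventually_at_right_field by (meson subsetD)
  qed auto
  then obtain b where b: "b > 0" "\<And>\<delta> k z. 0 < \<delta> \<Longrightarrow> \<delta> < b \<Longrightarrow> k < p \<Longrightarrow>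
      z \<in> {(f ^^ k) x..<(f ^^ k) x + \<delta>} \<Longrightarrow> d z = d ((f ^^ k) x)"
    unfolding eventually_at_right_field by blast
  define \<delta> where "\<delta> = b / 2"
  have \<delta>: "\<delta> > 0"
    using b(1) by (simp add: \<delta>_def)
  have const: "d z = d ((f ^^ k) x)" if "k < p" "z \<in> {(f ^^ k) x..<(f ^^ k) x + \<delta>}" for k z
    using b(1) that by (intro b(2)[of \<delta>]) (auto simp: \<delta>_def)
  define I where "I k = {(f ^^ k) x..<(f ^^ k) x + \<delta>}" for k
  have I [measurable]: "I k \<in> sets borel" for k
    by (simp add: I_def)
  \<comment> \<open>The \<open>p\<close> intervals have length \<delta> and may overlap, as
    \<open>p\<close> need not be the least period; the sum of indicators counts multiplicity, so the
    total mass is 1.\<close>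
  define M where "M = density lborel (\<lambda>z. ennreal (1 / (p * \<delta>)) * (\<Sum>k<p. indicator (I k) z))"
  have [simp]: "sets M = sets borel" "space M = UNIV"
    by (simp_all add: M_def)
  have M: "emeasure M A = ennreal (1 / (p * \<delta>)) * (\<Sum>k<p. emeasure lborel (I k \<inter> A))"
    if A [measurable]: "A \<in> sets borel" for A
  proof -
    have "emeasure M A = (\<integral>\<^sup>+z. ennreal (1 / (p * \<delta>)) * (\<Sum>k<p. indicator (I k) z) * indicator A z \<partial>lborel)"
      unfolding M_def by (subst emeasure_density) auto
    also have "\<dots> = (\<integral>\<^sup>+z. ennreal (1 / (p * \<delta>)) * (\<Sum>k<p. indicator (I k \<inter> A) z) \<partial>lborel)"
      by (intro nn_integral_cong) (simp add: indicator_def)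
    also have "\<dots> = ennreal (1 / (p * \<delta>)) * (\<Sum>k<p. emeasure lborel (I k \<inter> A))"
      by (simp add: nn_integral_cmult nn_integral_sum)
    finally show ?thesis .
  qed
  have "emeasure M UNIV = ennreal (1 / (p * \<delta>)) * ennreal (p * \<delta>)"
    using \<delta> by (subst M) (auto simp: I_def ennreal_mult' ennreal_of_nat_eq_real_of_nat)
  also have "\<dots> = ennreal (1 / (p * \<delta>) * (p * \<delta>))"
    using \<delta> by (intro ennreal_mult'[symmetric]) simp
  also have "1 / (p * \<delta>) * (p * \<delta>) = 1"
    using \<delta> \<open>p > 0\<close> by simp
  also have "ennreal 1 = 1"
    by simp
  finally have "real_distribution M"
    by (intro real_distribution.intro real_distribution_axioms.intro prob_spaceI) auto
  moreover have "emeasure M C = 0" if C: "countable C" for C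
  proof -
    have "C \<in> sets borel"
      using C by (rule sets.countable[rotated]) auto
    moreover have "emeasure lborel (I k \<inter> C) = 0" for k
      using C by (intro emeasure_lborel_countable) auto
    ultimately show ?thesis
      by (simp add: M)
  qed
  moreover have "emeasure M (f -` A) = emeasure M A"
    if A [measurable]: "A \<in> sets borel" and inv: "\<forall>x y. x - y \<in> \<int> \<longrightarrow> x \<in> A \<longrightarrow> y \<in> A" for A
  proof -
    have transl: "emeasure lborel ((\<lambda>z. c + z) -` B) = emeasure lborel B"
      if [measurable]: "B \<in> sets borel" for c :: real and B
    proof -
      have "emeasure lborel B = emeasure (distr lborel borel ((+) c)) B"
        by (simp add: lborel_distr_plus)
      also have "\<dots> = emeasure lborel ((\<lambda>z. c + z) -` B)"
        by (subst emeasure_distr) auto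
      finally show ?thesis by simp
    qed
    define e where "e k = emeasure lborel (I k \<inter> A)" for k
    have step: "emeasure lborel (I k \<inter> f -` A) = e (Suc k)" if "k < p" for k
    proof -
      define c where "c = d ((f ^^ k) x)"
      have I_Suc: "c + z \<in> I (Suc k) \<longleftrightarrow> z \<in> I k" for z
        by (auto simp: I_def f_def c_def)
      have f_eq: "f z = c + z" if "z \<in> I k" for z
        using const[OF \<open>k < p\<close>, of z] that by (simp only: I_def f_def c_def add.commute)
      have "I k \<inter> f -` A = (\<lambda>z. c + z) -` (I (Suc k) \<inter> A)"
        using I_Suc f_eq by auto
      also have "emeasure lborel \<dots> = e (Suc k)"
        unfolding e_def by (rule transl) simp
      finally show ?thesis .
    qed
    \<comment> \<open>The cycle closes here: the translation from \<open>I 0\<close> to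
      \<open>I p\<close> is by an integer and therefore preserves the periodic set
      \<open>A\<close>.\<close>
    have "I 0 \<inter> A = (\<lambda>z. ((f ^^ p) x - x) + z) -` (I p \<inter> A)"
    proof -
      have "((f ^^ p) x - x) + z \<in> A \<longleftrightarrow> z \<in> A" for z
        using inv per by (metis Ints_minus add_diff_cancel_right' minus_diff_eq)
      then show ?thesis
        by (auto simp: I_def)
    qed
    also have "emeasure lborel \<dots> = e p"
      unfolding e_def by (rule transl) simp
    finally have wrap: "e p = e 0"
      by (simp add: e_def)
    have fA: "f -` A \<in> sets borel"
      using measurable_sets[OF f_measurable A] by simp
    have "emeasure M (f -` A) = ennreal (1 / (p * \<delta>)) * (\<Sum>k<p. e (Suc k))"
      using step by (simp add: M fA)
    \<comment> \<open>Both sums consist of the terms \<open>e (Suc k)\<close> with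
      \<open>k < p - 1\<close> and one end term, \<open>e p\<close> or \<open>e 0\<close>; these
      agree by \<open>wrap\<close>.\<close>
    also have "(\<Sum>k<p. e (Suc k)) = (\<Sum>k<p. e k)"
      using sum.lessThan_Suc_shift[of e p] wrap
        sum.lessThan_Suc_shift[of e "p - 1"] sum.lessThan_Suc[of "\<lambda>k. e (Suc k)" "p - 1"] \<open>p > 0\<close>
      by (simp add: add.commute)
    also have "ennreal (1 / (p * \<delta>)) * (\<Sum>k<p. e k) = emeasure M A"
      by (simp add: M e_def)
    finally show ?thesis .
  qed
  ultimately show ?thesis
    unfolding atomless_invariant_def by blast
qed

lemma exists_atomless_invariant: "\<exists>M. atomless_invariant M"
  using exists_atomless_invariant_aperiodic exists_atomless_invariant_periodic by blast

end

subsection \<open>Measurability on the circle\<close>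

lemma proj_circle_measurable [measurable]: "proj_circle \<in> borel_measurable borel"
  by (intro borel_measurable_continuous_onI)
    (simp add: continuous_on_open_vimage open_circle_def[symmetric])

text \<open>The full preimage of the image of \<open>U\<close> is the union of its integer
  translates, each of them open.\<close>

lemma open_proj_circle_image:
  assumes "open U"
  shows "open (proj_circle ` U)"
proof -
  have "proj_circle -` (proj_circle ` U) = (\<Union>m\<in>\<int>. (+) m ` U)"
  proof (intro equalityI subsetI)
    fix x assume "x \<in> proj_circle -` (proj_circle ` U)"
    then obtain u where "u \<in> U" "x - u \<in> \<int>"
      by (auto simp: proj_circle_eq_iff)
    then show "x \<in> (\<Union>m\<in>\<int>. (+) m ` U)"
      by (intro UN_I[of "x - u"] image_eqI[of _ _ u]) auto
  next
    fix x assume "x \<in> (\<Union>m\<in>\<int>. (+) m ` U)"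
    then obtain m u where "m \<in> \<int>" "u \<in> U" "x = m + u"
      by blast
    then have "proj_circle x = proj_circle u"
      by (simp add: proj_circle_eq_iff)
    with \<open>u \<in> U\<close> show "x \<in> proj_circle -` (proj_circle ` U)"
      by auto
  qed
  then show ?thesis
    unfolding open_circle_def using assms by (auto intro: open_translation)
qed

text \<open>\<open>rep_circle\<close> picks an arbitrary representative; \<open>frac\<close>
  normalises it to \<open>[0, 1)\<close>, which makes the section measurable.\<close>

definition circle_section :: "circle \<Rightarrow> real"
  where "circle_section p = frac (rep_circle p)"

lemma proj_circle_section [simp]: "proj_circle (circle_section p) = p"
proof -
  have "proj_circle (circle_section p) = proj_circle (rep_circle p)"
    by (simp add: circle_section_def proj_circle_eq_iff frac_def)
  then show ?thesis
    using Quotient3_abs_rep[OF Quotient3_circle] by simp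
qed

lemma circle_section_bounds: "0 \<le> circle_section p" "circle_section p < 1"
  by (auto simp: circle_section_def frac_lt_1)

lemma circle_section_proj:
  assumes "0 \<le> x" "x < 1"
  shows "circle_section (proj_circle x) = x"
proof -
  have "circle_section (proj_circle x) - x \<in> \<int>"
    by (simp flip: proj_circle_eq_iff)
  then obtain m where m: "circle_section (proj_circle x) - x = of_int m"
    by (elim Ints_cases)
  then have "real_of_int m < 1" "-1 < real_of_int m"
    using assms circle_section_bounds[of "proj_circle x"] by linarith+
  then have "m = 0"
    by linarith
  with m show ?thesis
    by simp
qed

lemma circle_section_measurable [measurable]: "circle_section \<in> borel_measurable borel"
proof (subst borel_measurable_iff_le, intro allI)
  fix a :: real
  consider "a < 0" | "0 \<le> a" "a < 1" | "1 \<le> a"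
    by linarith
  then show "{p \<in> space borel. circle_section p \<le> a} \<in> sets borel"
  proof cases
    case 1
    then have "{p \<in> space borel. circle_section p \<le> a} = {}"
      by (auto simp: not_le intro: less_le_trans[OF _ circle_section_bounds(1)])
    then show ?thesis
      by (simp only: sets.empty_sets)
  next
    case 2
    have "{p \<in> space borel. circle_section p \<le> a} = proj_circle ` {0..a}"
    proof (intro equalityI subsetI)
      fix p assume "p \<in> {p \<in> space borel. circle_section p \<le> a}"
      then show "p \<in> proj_circle ` {0..a}"
        using circle_section_bounds(1)[of p] by (intro image_eqI[of _ _ "circle_section p"]) auto
    qed (use 2 circle_section_proj in auto)
    \<comment> \<open>The projection is known to map open sets to open sets, so the two end points
      are split off; for \<open>a = 0\<close> the open interval is empty.\<close>
    also have "{0..a} = insert 0 (insert a {0<..<a})"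
      using 2 by auto
    also have "proj_circle ` \<dots> = {proj_circle 0, proj_circle a} \<union> proj_circle ` {0<..<a}"
      by auto
    also have "\<dots> \<in> sets borel"
      by (intro sets.Un borel_closed finite_imp_closed borel_open open_proj_circle_image) auto
    finally show ?thesis .
  next
    case 3
    then have "{p \<in> space borel. circle_section p \<le> a} = space borel"
      by (auto intro: less_imp_le less_le_trans[OF circle_section_bounds(2)])
    then show ?thesis
      by (simp only: sets.top)
  qed
qed

lemma countable_Ints: "countable (\<int> :: real set)"
  by (simp add: Ints_def)

subsection \<open>Descent to the circle\<close>

text \<open>The measure is pushed forward along \<open>proj_circle\<close>. Preimages of Borel sets
  are 1-periodic, which is what the restricted invariance on the line covers.\<close>

lemma invariant_measure_from_lift:
  assumes "piecewise_translation d" and S: "\<And>x. S (proj_circle x) = proj_circle (x + d x)"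
  shows "\<exists>\<mu> :: circle measure. borel_probability_measure \<mu> \<and> invariant_measure \<mu> S \<and> non_atomic \<mu>"
proof -
  interpret piecewise_translation d by fact
  have S_f: "S (proj_circle x) = proj_circle (f x)" for x
    by (simp add: S f_def)
  obtain M where "atomless_invariant M"
    using exists_atomless_invariant by blast
  then have M: "real_distribution M"
    and null: "\<And>C. countable C \<Longrightarrow> emeasure M C = 0"
    and inv: "\<And>A. A \<in> sets borel \<Longrightarrow> (\<And>x y. x - y \<in> \<int> \<Longrightarrow> x \<in> A \<Longrightarrow> y \<in> A) \<Longrightarrow>
      emeasure M (f -` A) = emeasure M A"
    unfolding atomless_invariant_def by blast+
  interpret M: real_distribution M by fact
  define \<mu> where "\<mu> = distr M borel proj_circle"
  have [measurable_cong, simp]: "sets \<mu> = sets borel" and [simp]: "space \<mu> = UNIV"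
    by (simp_all add: \<mu>_def)
  have em: "emeasure \<mu> A = emeasure M (proj_circle -` A)" if "A \<in> sets borel" for A
    unfolding \<mu>_def using that by (subst emeasure_distr) auto
  \<comment> \<open>This composition is \<open>S\<close> itself, factored through the line.\<close>
  have "(\<lambda>p. proj_circle (f (circle_section p))) \<in> borel_measurable borel"
    by measurable
  then have S_borel: "S \<in> borel_measurable borel"
    by (simp flip: S_f)
  have "prob_space \<mu>"
    unfolding \<mu>_def by (intro M.prob_space_distr) measurable
  then have "borel_probability_measure \<mu>"
    by (simp add: borel_probability_measure_def)
  moreover have "invariant_measure \<mu> S"
    unfolding invariant_measure_def
  proof (intro conjI ballI)
    show "S \<in> measurable \<mu> \<mu>"
      using S_borel by measurable
    fix A assume "A \<in> sets \<mu>"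
    then have A: "A \<in> sets borel"
      by simp
    have "emeasure \<mu> (S -` A) = emeasure M (proj_circle -` (S -` A))"
      using measurable_sets[OF S_borel A] by (intro em) simp
    also have "proj_circle -` (S -` A) = f -` (proj_circle -` A)"
      by (auto simp: S_f)
    also have "emeasure M \<dots> = emeasure M (proj_circle -` A)"
    proof (rule inv)
      show "proj_circle -` A \<in> sets borel"
        using measurable_sets[OF proj_circle_measurable A] by simp
      show "y \<in> proj_circle -` A" if "x - y \<in> \<int>" "x \<in> proj_circle -` A" for x y
        using that proj_circle_eq_iff[of x y] by simp
    qed
    also have "\<dots> = emeasure \<mu> A"
      using A by (simp add: em)
    finally show "emeasure \<mu> (S -` A \<inter> space \<mu>) = emeasure \<mu> A"
      by simp
  qed
  moreover have "non_atomic \<mu>"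
    unfolding non_atomic_def
  proof
    fix p
    \<comment> \<open>Fibres of the projection are cosets of the integers, hence countable and
      null.\<close>
    have "proj_circle -` {p} \<subseteq> (\<lambda>m. circle_section p + m) ` \<int>"
    proof
      fix x assume "x \<in> proj_circle -` {p}"
      then have "proj_circle x = proj_circle (circle_section p)"
        by simp
      then have "x - circle_section p \<in> \<int>"
        by (simp only: proj_circle_eq_iff)
      then show "x \<in> (\<lambda>m. circle_section p + m) ` \<int>"
        by (intro image_eqI[of _ _ "x - circle_section p"]) auto
    qed
    then have "countable (proj_circle -` {p})"
      using countable_Ints countable_image countable_subset by blast
    then show "emeasure \<mu> {p} = 0"
      using null by (simp add: em borel_closed)
  qed
  ultimately show ?thesis
    by blast
qed

section \<open>The displacement function of an interval translation map\<close>

lemma interval_translation_map_lift: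
  assumes "interval_translation_map S"
  obtains d where "piecewise_translation d" "\<And>x. S (proj_circle x) = proj_circle (x + d x)"
proof -
  obtain n t c where cyc: "cyclic_lift n t"
    and S: "\<And>j x. j < n \<Longrightarrow> x \<in> {t j..<t (Suc j)} \<Longrightarrow> S (proj_circle x) = proj_circle (x + c j)"
    using assms unfolding interval_translation_map_def by blast
  \<comment> \<open>The index is unique because the arcs are disjoint. Since it depends only on the
    point of the circle, \<open>d\<close> is periodic.\<close>
  define J where "J p = (THE j. j < n \<and> p \<in> arc_circle (t j) (t (Suc j)))" for p
  define d where "d x = c (J (proj_circle x))" for x
  have J_eq: "J p = j" if "j < n" "p \<in> arc_circle (t j) (t (Suc j))" for p j
    unfolding J_def using that cyclic_lift_disjoint[OF cyc]
    by (intro the_equality) (auto simp: disjoint_family_on_def)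
  have d_eq: "d x = c j" if "j < n" "m \<in> \<int>" "t j \<le> x - m" "x - m < t (Suc j)" for x m j
  proof -
    have "proj_circle x = proj_circle (x - m)"
      using that by (simp add: proj_circle_eq_iff)
    then have "proj_circle x \<in> arc_circle (t j) (t (Suc j))"
      using that by (auto simp: arc_circle_def)
    then show ?thesis
      using that by (simp add: d_def J_eq)
  qed
  have cover: "\<exists>j<n. \<exists>m\<in>\<int>. t j \<le> x - m \<and> x - m < t (Suc j)" for x
  proof -
    have "proj_circle x \<in> (\<Union>j<n. arc_circle (t j) (t (Suc j)))"
      by (simp add: cyclic_lift_cover[OF cyc])
    then obtain j u where "j < n" "t j \<le> u" "u < t (Suc j)" "x - u \<in> \<int>"
      by (auto simp: arc_circle_def proj_circle_eq_iff)
    then show ?thesis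
      by (intro exI[of _ j] conjI bexI[of _ "x - u"]) auto
  qed
  \<comment> \<open>This finds the arc just to the left of \<open>x\<close>; it differs from the arc
    containing \<open>x\<close> only at a left end point.\<close>
  have cover_left: "\<exists>j<n. \<exists>m\<in>\<int>. t j < x - m \<and> x - m \<le> t (Suc j)" for x
  proof -
    obtain j m where j: "j < n" "m \<in> \<int>" "t j \<le> x - m" "x - m < t (Suc j)"
      using cover by blast
    show ?thesis
    proof (cases "t j = x - m")
      case False
      with j show ?thesis
        by (intro exI[of _ j] conjI bexI[of _ m]) auto
    next
      case True
      show ?thesis
      proof (cases j)
        case (Suc i)
        then have "t i < t j"
          using cyc j(1) by (simp add: cyclic_lift_def)
        with Suc True j show ?thesis
          by (intro exI[of _ i] conjI bexI[of _ m]) auto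
      next
        case 0
        obtain i where i: "n = Suc i"
          using j(1) by (cases n) auto
        have "t i < t n" "t n = t 0 + 1"
          using cyc i by (auto simp: cyclic_lift_def)
        \<comment> \<open>To the left of \<open>t 0\<close> lies the last arc, one turn earlier, so
          \<open>m\<close> becomes \<open>m - 1\<close>.\<close>
        with 0 True j i show ?thesis
          by (intro exI[of _ i] conjI bexI[of _ "m - 1"]) auto
      qed
    qed
  qed
  have "piecewise_translation d"
  proof
    show "d x = d y" if "x - y \<in> \<int>" for x y
      using that proj_circle_eq_iff[of x y] by (simp add: d_def)
    show "\<exists>\<delta>>0. \<forall>z\<in>{y..<y+\<delta>}. d z = d y" for y
    proof -
      obtain j m where j: "j < n" "m \<in> \<int>" "t j \<le> y - m" "y - m < t (Suc j)"
        using cover by blast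
      have "d z = d y" if "z \<in> {y..<y + (t (Suc j) - (y - m))}" for z
      proof -
        have "d z = c j"
          using j that by (intro d_eq[of j m]) auto
        also have "\<dots> = d y"
          using j by (intro d_eq[symmetric])
        finally show ?thesis .
      qed
      moreover have "t (Suc j) - (y - m) > 0"
        using j by simp
      ultimately show ?thesis
        by blast
    qed
    show "\<exists>\<delta>>0. \<exists>c. \<forall>z\<in>{y-\<delta><..<y}. d z = c" for y
    proof -
      obtain j m where j: "j < n" "m \<in> \<int>" "t j < y - m" "y - m \<le> t (Suc j)"
        using cover_left by blast
      have "d z = c j" if "z \<in> {y - (y - m - t j)<..<y}" for z
        using j that by (intro d_eq[of j m]) auto
      moreover have "y - m - t j > 0"
        using j by simp
      ultimately show ?thesis
        by blast
    qed
    have "d x \<in> c ` {..<n}" for x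
      using cover[of x] d_eq by (metis image_eqI lessThan_iff)
    then show "countable (range d)"
      by (meson countable_finite finite_imageI finite_lessThan finite_subset image_subsetI)
    \<comment> \<open>All real lifts of the arc end points; \<open>d\<close> is locally constant
      elsewhere.\<close>
    define X where "X = (\<Union>j<n. (\<lambda>m. t j + m) ` \<int>)"
    have "isCont d x" if "x \<notin> X" for x
    proof -
      obtain j m where j: "j < n" "m \<in> \<int>" "t j \<le> x - m" "x - m < t (Suc j)"
        using cover by blast
      have "x \<noteq> t j + m"
        using that j unfolding X_def by blast
      then have "x \<in> {t j + m<..<t (Suc j) + m}"
        using j by auto
      moreover have "d z = c j" if "z \<in> {t j + m<..<t (Suc j) + m}" for z
        using that j by (intro d_eq[of j m]) auto
      ultimately have "\<forall>\<^sub>F z in nhds x. d z = c j"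
        unfolding eventually_nhds by (intro exI[of _ "{t j + m<..<t (Suc j) + m}"]) auto
      then show ?thesis
        using isCont_cong by fastforce
    qed
    moreover have "countable X"
      unfolding X_def by (intro countable_UN countable_image countable_Ints) auto
    ultimately show "countable {x. \<not> isCont d x}"
      by (elim countable_subset[rotated]) blast
  qed
  moreover have "S (proj_circle x) = proj_circle (x + d x)" for x
  proof -
    obtain j m where j: "j < n" "m \<in> \<int>" "t j \<le> x - m" "x - m < t (Suc j)"
      using cover by blast
    have "S (proj_circle x) = S (proj_circle (x - m))"
      using j(2) by (intro arg_cong[of _ _ S]) (simp add: proj_circle_eq_iff)
    also have "\<dots> = proj_circle (x - m + c j)"
      using j by (intro S) auto
    also have "\<dots> = proj_circle (x + d x)"
      using j(2) by (simp add: d_eq[OF j] proj_circle_eq_iff)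
    finally show ?thesis .
  qed
  ultimately show thesis
    by (rule that)
qed

theorem theorem2p2:
  fixes S :: "circle \<Rightarrow> circle"
  assumes "interval_translation_map S"
  shows "\<exists>\<mu> :: circle measure. borel_probability_measure \<mu> \<and> invariant_measure \<mu> S \<and> non_atomic \<mu>"
  using interval_translation_map_lift[OF assms] invariant_measure_from_lift by blast

end
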